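(* Let $A,B,c\in\mathbb{R}$ satisfy $c = 1+\frac{A+B}{2}$ and $B+2<c<A$. Then there exists a discontinuous profile function $W$ (that is, a profile function with $W(0-)\neq W(0+)$) with $\lim_{\xi\to-\infty}W(\xi)=A$ and $\lim_{\xi\to+\infty}W(\xi)=B$ such that the traveling wave $u(x,t)=W(x-ct)$ is a weak solution of the Cauchy problem for the Fornberg-Whitham equation $u_t+uu_x+K\ast u_x=0$, $u(x,0)=u_0(x)$, with initial value $u_0=W$.
   Context: The kernel is $K(x)=\frac12 e^{-|x|}$ on $\mathbb{R}$, and $K'(x)=-\frac12\,\mathrm{sgn}(x)e^{-|x|}$. Convolutions are in the spatial variable only. Weak solution: a function $u\in L^\infty_{\mathrm{loc}}(\mathbb{R}\times[0,\infty))$ is a weak solution of the Cauchy problem $u_t+uu_x+K\ast u_x=0$, $u(\cdot,0)=u_0$, with $u_0\in L^\infty_{\mathrm{loc}}(\mathbb{R})$, if $$\int_0^\infty\int_{-\infty}^\infty\Big(-u(x,t)\,\partial_t\phi(x,t)-\frac{u^2(x,t)}{2}\,\partial_x\phi(x,t)+\big(K'\ast u(\cdot,t)\big)(x)\,\phi(x,t)\Big)\,dx\,dt=\int_{-\infty}^\infty u_0(x)\,\phi(x,0)\,dx$$ for every test function $\phi\in C_c^\infty(\mathbb{R}^2)$. Profile function: a function $W\colon\mathbb{R}\to\mathbb{R}$ which is $C^2$ on $\mathbb{R}\setminus\{0\}$, such that $W,W',W''$ possess (finite) one-sided limits at $0$, and such that $W(\xi)$ has finite limits as $\xi\to-\infty$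 and as $\xi\to+\infty$. $W(0\pm)$ denote the one-sided limits at $0$. *)

theory Defs
  imports "HOL-Analysis.Analysis"
begin

text \<open>Continuous differentiability of order \<open>k\<close> on an open set \<open>S\<close>. In the recursive
  clause \<open>v\<close> ranges over all directions; in finite dimension this amounts to
  the partial derivatives.\<close>

primrec Ck_on :: "nat \<Rightarrow> ('a::euclidean_space \<Rightarrow> 'b::real_normed_vector) \<Rightarrow> 'a set \<Rightarrow> bool" where
  "Ck_on 0 f S \<longleftrightarrow> continuous_on S f"
| "Ck_on (Suc k) f S \<longleftrightarrow>
     (\<forall>x\<in>S. f differentiable (at x)) \<and> (\<forall>v. Ck_on k (\<lambda>x. frechet_derivative f (at x) v) S)"

definition test_function :: "('a::euclidean_space \<Rightarrow> real) \<Rightarrow> bool" where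
  "test_function \<phi> \<longleftrightarrow> (\<forall>k. Ck_on k \<phi> UNIV) \<and> compact (closure {p. \<phi> p \<noteq> 0})"

definition Linf_loc :: "'a::euclidean_space set \<Rightarrow> ('a \<Rightarrow> real) \<Rightarrow> bool" where
  "Linf_loc S f \<longleftrightarrow> set_borel_measurable lebesgue S f \<and>
     (\<forall>C. compact C \<and> C \<subseteq> S \<longrightarrow> (\<exists>M. AE p in lebesgue. p \<in> C \<longrightarrow> \<bar>f p\<bar> \<le> M))"

definition convolution :: "(real \<Rightarrow> real) \<Rightarrow> (real \<Rightarrow> real) \<Rightarrow> real \<Rightarrow> real" where
  "convolution f g x = (LINT y|lebesgue. f (x - y) * g y)"

definition kernel :: "real \<Rightarrow> real" where
  "kernel x = exp (- \<bar>x\<bar>) / 2"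

definition kernel_deriv :: "real \<Rightarrow> real" where
  "kernel_deriv x = - (sgn x * exp (- \<bar>x\<bar>)) / 2"

lemma kernel_has_real_derivative:
  assumes "x \<noteq> 0"
  shows "(kernel has_real_derivative kernel_deriv x) (at x)"
proof (cases "x > 0")
  case True
  have "((\<lambda>y. exp (- y) / 2) has_real_derivative kernel_deriv x) (at x)"
    using True by (auto simp: kernel_deriv_def intro!: derivative_eq_intros)
  then show ?thesis
    by (rule has_field_derivative_transform_within_open[where S = "{0<..}"])
       (use True in \<open>auto simp: kernel_def\<close>)
next
  case False
  with assms have neg: "x < 0" by simp
  have "((\<lambda>y. exp y / 2) has_real_derivative kernel_deriv x) (at x)"
    using neg by (auto simp: kernel_deriv_def intro!: derivative_eq_intros)
  then show ?thesis
    by (rule has_field_derivative_transform_within_open[where S = "{..<0}"])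
       (use neg in \<open>auto simp: kernel_def\<close>)
qed

definition weak_integrand ::
    "(real \<Rightarrow> real \<Rightarrow> real) \<Rightarrow> (real \<times> real \<Rightarrow> real) \<Rightarrow> real \<Rightarrow> real \<Rightarrow> real" where
  "weak_integrand u \<phi> x t =
     - u x t * deriv (\<lambda>s. \<phi> (x, s)) t
     - (u x t)\<^sup>2 / 2 * deriv (\<lambda>y. \<phi> (y, t)) x
     + convolution kernel_deriv (\<lambda>y. u y t) x * \<phi> (x, t)"

text \<open>Arguments of \<open>u\<close> are position and time; only its values for \<open>t \<ge> 0\<close> matter.
  The two integrability clauses say that the convolution and the double integral exist as
  Lebesgue integrals. They have to be explicit because the Bochner integral of a non-integrable
  function is 0 by convention, and local boundedness of \<open>u\<close> does not imply them. All other
  terms are automatically integrable.\<close>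

definition FW_weak_solution :: "(real \<Rightarrow> real \<Rightarrow> real) \<Rightarrow> (real \<Rightarrow> real) \<Rightarrow> bool" where
  "FW_weak_solution u u0 \<longleftrightarrow>
     Linf_loc (UNIV \<times> {0..}) (\<lambda>(x, t). u x t) \<and>
     Linf_loc UNIV u0 \<and>
     (AE (x, t) in lebesgue. t \<ge> 0 \<longrightarrow> integrable lebesgue (\<lambda>y. kernel_deriv (x - y) * u y t)) \<and>
     (\<forall>\<phi>. test_function \<phi> \<longrightarrow>
        set_integrable lebesgue (UNIV \<times> {0..}) (\<lambda>(x, t). weak_integrand u \<phi> x t) \<and>
        (LINT t:{0..}|lebesgue. (LINT x|lebesgue. weak_integrand u \<phi> x t))
          = (LINT x|lebesgue. u0 x * \<phi> (x, 0)))"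

definition profile_function :: "(real \<Rightarrow> real) \<Rightarrow> bool" where
  "profile_function W \<longleftrightarrow>
     Ck_on 2 W (- {0}) \<and>
     (\<forall>f \<in> {W, deriv W, deriv (deriv W)}.
        (\<exists>l. (f \<longlongrightarrow> l) (at_left 0)) \<and> (\<exists>l. (f \<longlongrightarrow> l) (at_right 0))) \<and>
     (\<exists>l. (W \<longlongrightarrow> l) at_bot) \<and> (\<exists>l. (W \<longlongrightarrow> l) at_top)"

end

theory Submission
  imports Defs
begin

text \<open>
  Write \<open>V = W - c\<close> and let \<open>P\<close> be the convolution of \<open>K\<close> with \<open>V\<close>. Since \<open>K\<close> is the Green
  function of \<open>1 - d\<^sup>2/d\<xi>\<^sup>2\<close>, the relation \<open>P - P'' = V\<close> holds, and integrating the
  equation for a travelling wave once turns it into \<open>V\<^sup>2/2 + P = E\<close> with a constant \<open>E\<close>. Hence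
  \<open>y = V\<^sup>2/2\<close> is continuously differentiable even where \<open>V\<close> jumps, so that a jump can only
  replace \<open>V\<close> by \<open>-V\<close>, and \<open>y'' = y - E + V\<close> on either side of it.

  On each side \<open>v = -V\<close> thus solves a second order equation with a first integral. Requiring
  \<open>v\<close> to converge to a constant \<open>q\<close>, where \<open>E = q\<^sup>2/2 - q\<close>, fixes the value of the first integral:
  \<open>(v v')\<^sup>2/2\<close> is a quartic in \<open>v\<close> with a double zero at \<open>q\<close>. Taking a square root leaves the scalar
  autonomous equation \<open>v' = branch_slope q v\<close> (with the direction of \<open>\<xi>\<close> reversed on the left), whose
  right hand side vanishes linearly at \<open>q\<close>; its orbit therefore exists for all later times and converges to \<open>q\<close>
  (\<open>autonomous_orbit_to_equilibrium\<close>, \<open>branch_exists\<close>).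

  With \<open>m = (A - B)/2 > 1\<close> the limits of \<open>v\<close> are \<open>1 - m\<close> on the left and \<open>1 + m\<close> on the right, and
  both give \<open>E = (m\<^sup>2 - 1)/2\<close>. The two branches have to meet with \<open>v\<close> of opposite sign and with equal
  \<open>y'\<close>. This happens exactly at the values \<open>-m\<close> and \<open>m\<close>, so the jump has height \<open>2 m\<close>,
  centred at \<open>c\<close>.

  Conversely, let \<open>P\<close> be defined by the energy relation from the glued profile. Then \<open>P\<close> is
  continuously differentiable and \<open>P'' = P - W\<close> off the jump (with \<open>P\<close> shifted by \<open>c\<close>). Integrating by
  parts against the exponential kernel gives \<open>K' * W = P'\<close> pointwise
  (\<open>convolution_kernel_deriv\<close>). In the weak formulation \<open>P'\<close> is integrated by parts onto the test
  function, the energy relation cancels everything except the derivative of the test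
  function along the lines \<open>x - c t = const\<close>, and integrating along these lines leaves the initial
  datum (\<open>weak_solution_of_profile\<close>).
\<close>

section \<open>Orbits of scalar autonomous equations\<close>

lemma has_real_derivative_inverse_on:
  fixes f g :: "real \<Rightarrow> real"
  assumes "open S" "x \<in> S" "continuous_on S f" "(f has_real_derivative f') (at x)" "f' \<noteq> 0"
    and "\<And>z. z \<in> S \<Longrightarrow> g (f z) = z"
  shows "(g has_real_derivative inverse f') (at (f x))"
  using assms unfolding has_field_derivative_def
  by (intro has_derivative_inverse_strong[of S x f g]) auto

text \<open>
  Separation of variables: an antiderivative \<open>F\<close> of \<open>1/h\<close> is the time needed to travel from \<open>m\<close>, so its
  inverse is the orbit. Because \<open>h v \<le> L * (q - v)\<close>, this time grows at least like
  \<open>- ln (q - v) / L\<close>, which makes the orbit live forever and only approach \<open>q\<close>. Since \<open>m\<close> is an interior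
  point, the orbit also extends a little into the past; this is what later supplies the one-sided
  limits of all derivatives at the jump.
\<close>

lemma autonomous_orbit_to_equilibrium:
  fixes h :: "real \<Rightarrow> real" and p m q L :: real
  assumes "p < m" "m < q" and cont: "continuous_on {p<..<q} h"
    and pos: "\<And>v. p < v \<Longrightarrow> v < q \<Longrightarrow> h v > 0"
    and lin: "\<And>v. m \<le> v \<Longrightarrow> v < q \<Longrightarrow> h v \<le> L * (q - v)" and "L > 0"
  obtains \<delta> w where "\<delta> > 0" "w 0 = m" "(w \<longlongrightarrow> q) at_top"
    "\<And>s. s > -\<delta> \<Longrightarrow> p < w s \<and> w s < q \<and> (w has_real_derivative h (w s)) (at s)"
proof -
  have hc: "isCont h v" if "p < v" "v < q" for v
    using cont that by (simp add: continuous_on_eq_continuous_at)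
  have "\<exists>F0. \<forall>v::real. ereal p < v \<longrightarrow> v < ereal q \<longrightarrow> (F0 has_vector_derivative inverse (h v)) (at v)"
    using assms(1,2) hc pos
    by (intro einterval_antiderivative) (auto intro!: continuous_intros simp: less_imp_neq[symmetric])
  then obtain F0 where F0:
      "\<And>v. p < v \<Longrightarrow> v < q \<Longrightarrow> (F0 has_real_derivative inverse (h v)) (at v)"
    by (auto simp: has_real_derivative_iff_has_vector_derivative)
  define F where "F v = F0 v - F0 m" for v
  have F: "(F has_real_derivative inverse (h v)) (at v)" if "p < v" "v < q" for v
    unfolding F_def[abs_def] using F0[OF that] by (auto intro!: derivative_eq_intros)
  have Fm: "F m = 0" by (simp add: F_def)
  have Fmono: "F u < F v" if "p < u" "u < v" "v < q" for u v
    by (rule DERIV_pos_imp_increasing[OF that(2)])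
       (use F pos that in \<open>meson positive_imp_inverse_positive le_less_trans less_le_trans\<close>)
  have Finj: "u = v" if "p < u" "u < q" "p < v" "v < q" "F u = F v" for u v
    using Fmono[of u v] Fmono[of v u] that by (cases u v rule: linorder_cases) auto
  have Fcont: "continuous_on {u..v} F" if "p < u" "v < q" for u v
    using that by (intro continuous_at_imp_continuous_on ballI DERIV_isCont[OF F]) auto
  have Flow: "(ln (q - m) - ln (q - v)) / L \<le> F v" if "m \<le> v" "v < q" for v
  proof -
    have "F m - (ln (q - m) - ln (q - m)) / L \<le> F v - (ln (q - m) - ln (q - v)) / L"
    proof (rule DERIV_nonneg_imp_nondecreasing[OF that(1)])
      fix x assume x: "m \<le> x" "x \<le> v"
      have x': "p < x" "x < q" "h x > 0" using x that assms pos by auto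
      have "((\<lambda>v. F v - (ln (q - m) - ln (q - v)) / L) has_real_derivative
             inverse (h x) - inverse (L * (q - x))) (at x)"
        using x' \<open>L > 0\<close> by (auto intro!: derivative_eq_intros F simp: field_simps)
      moreover have "inverse (L * (q - x)) \<le> inverse (h x)"
        using lin[of x] x x' by (intro le_imp_inverse_le) auto
      ultimately show "\<exists>y. ((\<lambda>v. F v - (ln (q - m) - ln (q - v)) / L) has_real_derivative y) (at x)
                           \<and> 0 \<le> y" by force
    qed
    then show ?thesis by (simp add: Fm)
  qed
  define \<delta> where "\<delta> = - F ((p + m) / 2)"
  have \<delta>: "\<delta> > 0" using Fmono[of "(p+m)/2" m] assms Fm by (simp add: \<delta>_def)
  have ex: "\<exists>v. p < v \<and> v < q \<and> F v = s" if "s > -\<delta>" for s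
  proof -
    \<comment> \<open>By the lower bound on \<open>F\<close>, the time to reach \<open>v1\<close> is at least \<open>\<bar>s\<bar>\<close>.\<close>
    define k where "k = (q - m) * exp (- L * \<bar>s\<bar>)"
    define v1 where "v1 = q - k"
    have "k \<le> q - m"
      using assms unfolding k_def by (intro mult_left_le) auto
    moreover have "k > 0"
      using assms unfolding k_def by (intro mult_pos_pos) auto
    ultimately have v1: "m \<le> v1" "v1 < q"
      unfolding v1_def by simp_all
    have "ln (q - v1) = ln (q - m) - L * \<bar>s\<bar>"
      using assms unfolding v1_def k_def by (simp add: ln_mult)
    then have "\<bar>s\<bar> \<le> F v1" using Flow[OF v1] \<open>L > 0\<close> by simp
    then have upper: "s \<le> F v1" by linarith
    have lower: "F ((p + m) / 2) \<le> s" using that by (simp add: \<delta>_def)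
    have "p < (p + m) / 2" "(p + m) / 2 \<le> v1"
      using assms(1) v1 by (simp_all add: field_simps)
    then obtain v where "(p + m) / 2 \<le> v" "v \<le> v1" "F v = s"
      using IVT'[of F "(p + m) / 2" s v1] Fcont[of "(p + m) / 2" v1] lower upper v1 by auto
    then show ?thesis
      using \<open>p < (p + m) / 2\<close> v1 by (intro exI[of _ v]) linarith
  qed
  define w where "w s = (THE v. p < v \<and> v < q \<and> F v = s)" for s
  have wF: "w (F v) = v" if "p < v" "v < q" for v
    unfolding w_def using that Finj by (intro the_equality) auto
  have w: "p < w s \<and> w s < q \<and> F (w s) = s" if "s > -\<delta>" for s
    using ex[OF that] wF by force
  have wd: "(w has_real_derivative h (w s)) (at s)" if "s > -\<delta>" for s
  proof -
    have "(w has_real_derivative inverse (inverse (h (w s)))) (at (F (w s)))"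
      by (rule has_real_derivative_inverse_on[where f = F and x = "w s" and S = "{p<..<q}"])
         (use w[OF that] F wF pos[of "w s"] in
           \<open>force intro!: continuous_at_imp_continuous_on intro: DERIV_isCont[OF F]\<close>)+
    then show ?thesis using w[OF that] by simp
  qed
  have "(w \<longlongrightarrow> q) at_top"
  proof (rule order_tendstoI)
    fix a assume "a < q"
    define v where "v = max a m"
    have v: "p < v" "v < q" "a \<le> v" using assms \<open>a < q\<close> by (auto simp: v_def)
    have "a < w s" if "s > max 0 (F v)" for s
      using w[of s] that \<delta> v Fmono[of "w s" v] by (cases "w s" v rule: linorder_cases) auto
    then show "eventually (\<lambda>s. a < w s) at_top"
      using eventually_gt_at_top[of "max 0 (F v)"] by (auto elim: eventually_mono)
  next
    fix a assume "q < a"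
    show "eventually (\<lambda>s. w s < a) at_top"
    proof (rule eventually_mono[OF eventually_gt_at_top[of 0]])
      show "w s < a" if "s > 0" for s using w[of s] \<delta> that \<open>q < a\<close> by linarith
    qed
  qed
  moreover have "w 0 = m" using wF[of m] Fm assms by simp
  ultimately show ?thesis using that[of \<delta> w] \<delta> w wd by blast
qed

section \<open>The smooth branches of the profile\<close>

text \<open>
  With \<open>E = q\<^sup>2/2 - q\<close> and \<open>G v = v^4/8 - v^3/3 - E * v\<^sup>2/2\<close>, the point \<open>q\<close> is critical for \<open>G\<close>, and
  \<open>G v - G q = (q - v)\<^sup>2 * energy_cofactor q v / 8\<close>.
\<close>

definition energy_cofactor :: "real \<Rightarrow> real \<Rightarrow> real" where
  "energy_cofactor q v = (v + q)\<^sup>2 - (8 * v + 4 * q) / 3"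

text \<open>
  The increasing solution of \<open>(v * v')\<^sup>2 / 2 = G v - G q\<close> below \<open>q\<close>, solved for \<open>v'\<close>.
\<close>

definition branch_slope :: "real \<Rightarrow> real \<Rightarrow> real" where
  "branch_slope q v = (q - v) * sqrt (energy_cofactor q v) / (2 * \<bar>v\<bar>)"

lemma branch_slope_energy: 
  assumes "v \<noteq> 0" "energy_cofactor q v > 0"
  shows "(v * branch_slope q v)\<^sup>2 = (q - v)\<^sup>2 * energy_cofactor q v / 4"
  using assms by (simp add: branch_slope_def power_mult_distrib power_divide)

text \<open>
  The second derivative along an orbit of \<open>v' = branch_slope q v\<close>, with the square root eliminated:
  differentiate the energy identity, which is polynomial in \<open>v\<close> on its right hand side, instead of the
  explicit formula for the slope.
\<close>

lemma branch_slope_chain_rule: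
  assumes "v \<noteq> 0" "energy_cofactor q v > 0"
  obtains D where "(branch_slope q has_real_derivative D) (at v)"
    "D * branch_slope q v = (v\<^sup>2 / 2 - v - (q\<^sup>2 / 2 - q) - (branch_slope q v)\<^sup>2) / v"
proof -
  \<comment> \<open>Freezing the sign of \<open>v\<close> turns the absolute value in the slope into a linear factor.\<close>
  define k where "k = sgn v"
  have "k * v \<noteq> 0" using assms by (simp add: k_def sgn_zero_iff)
  moreover have dR: "(\<lambda>x. sqrt (energy_cofactor q x)) differentiable (at v)"
  proof -
    have "((\<lambda>x. sqrt (energy_cofactor q x)) has_real_derivative
            inverse (sqrt (energy_cofactor q v)) / 2 * (2 * (v + q) - 8 / 3)) (at v)"
      using assms unfolding energy_cofactor_def by (auto intro!: derivative_eq_intros)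
    then show ?thesis by (auto simp: real_differentiable_def)
  qed
  ultimately have "(\<lambda>x. (q - x) * sqrt (energy_cofactor q x) / (2 * (k * x))) differentiable (at v)"
    using dR by (intro derivative_intros) auto
  then obtain D where "((\<lambda>x. (q - x) * sqrt (energy_cofactor q x) / (2 * (k * x))) has_real_derivative D) (at v)"
    by (auto simp: real_differentiable_def)
  then have "(branch_slope q has_real_derivative D) (at v)"
  proof (rule has_field_derivative_transform_within_open[where S = "{x. x * v > 0}"])
    show "open {x. x * v > 0}" by (intro open_Collect_less continuous_intros)
    show "(q - x) * sqrt (energy_cofactor q x) / (2 * (k * x)) = branch_slope q x" if "x \<in> {x. x * v > 0}" for x
      using that by (auto simp: branch_slope_def k_def sgn_if zero_less_mult_iff)
  qed (use assms in \<open>auto simp: zero_less_mult_iff\<close>)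
  then have "branch_slope q differentiable (at v)"
    by (auto simp: real_differentiable_def)
  then obtain D where D: "(branch_slope q has_real_derivative D) (at v)"
    by (auto simp: real_differentiable_def)
  have "((\<lambda>v. (v * branch_slope q v)\<^sup>2) has_real_derivative 2 * (v * branch_slope q v) * (branch_slope q v + v * D)) (at v)"
    using D by (auto intro!: derivative_eq_intros)
  moreover have "((\<lambda>v. (v * branch_slope q v)\<^sup>2) has_real_derivative 2 * v * (v\<^sup>2 / 2 - v - (q\<^sup>2 / 2 - q))) (at v)"
  proof (rule has_field_derivative_transform_within_open[where S = "{x. x \<noteq> 0 \<and> energy_cofactor q x > 0}"])
    show "((\<lambda>v. (q - v)\<^sup>2 * energy_cofactor q v / 4) has_real_derivative 2 * v * (v\<^sup>2 / 2 - v - (q\<^sup>2 / 2 - q))) (at v)"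
      unfolding energy_cofactor_def by (auto intro!: derivative_eq_intros) (simp add: field_simps power2_eq_square)
    show "open {x. x \<noteq> 0 \<and> energy_cofactor q x > 0}"
      unfolding energy_cofactor_def by (intro open_Collect_conj open_Collect_neq open_Collect_less continuous_intros) auto
  qed (use assms branch_slope_energy in auto)
  ultimately have "2 * (v * branch_slope q v) * (branch_slope q v + v * D) = 2 * v * (v\<^sup>2 / 2 - v - (q\<^sup>2 / 2 - q))"
    by (rule DERIV_unique)
  then have "v * (branch_slope q v * (branch_slope q v + v * D)) = v * (v\<^sup>2 / 2 - v - (q\<^sup>2 / 2 - q))" by simp
  then have "branch_slope q v * (branch_slope q v + v * D) = v\<^sup>2 / 2 - v - (q\<^sup>2 / 2 - q)"
    by (rule iffD1[OF mult_left_cancel[OF assms(1)]])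
  then have "D * branch_slope q v = (v\<^sup>2 / 2 - v - (q\<^sup>2 / 2 - q) - (branch_slope q v)\<^sup>2) / v"
    using assms by (simp add: field_simps power2_eq_square)
  with D show ?thesis using that by blast
qed

text \<open>
  One half of the wave profile. The last property bounds the derivative of \<open>(w s)\<^sup>2 / 2\<close>, that is, up
  to sign, the convolution term of the equation.
\<close>

lemma branch_exists:
  assumes "p < v0" "v0 < q"
    and ok: "\<And>v. p < v \<Longrightarrow> v \<le> q \<Longrightarrow> v \<noteq> 0 \<and> energy_cofactor q v > 0"
  obtains \<delta> w N where "\<delta> > 0" "w 0 = v0" "(w \<longlongrightarrow> q) at_top"
    "\<And>s. s > -\<delta> \<Longrightarrow> p < w s \<and> w s < q \<and> (w has_real_derivative branch_slope q (w s)) (at s)"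
    "\<And>s. s > -\<delta> \<Longrightarrow> ((\<lambda>s. branch_slope q (w s)) has_real_derivative
        ((w s)\<^sup>2 / 2 - w s - (q\<^sup>2 / 2 - q) - (branch_slope q (w s))\<^sup>2) / w s) (at s)"
    "\<And>s. s > -\<delta> \<Longrightarrow> \<bar>w s * branch_slope q (w s)\<bar> \<le> N"
proof -
  define g where "g v = sqrt (energy_cofactor q v) / (2 * \<bar>v\<bar>)" for v
  have gcont: "continuous_on {v0..q} g"
    unfolding g_def energy_cofactor_def using ok assms by (intro continuous_intros) force+
  have "\<exists>x\<in>{v0..q}. \<forall>y\<in>{v0..q}. g y \<le> g x"
    using assms gcont by (intro continuous_attains_sup) auto
  then obtain x where x: "v0 \<le> x" "x \<le> q" "\<And>y. v0 \<le> y \<Longrightarrow> y \<le> q \<Longrightarrow> g y \<le> g x" by auto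
  have gpos: "g v > 0" if "p < v" "v \<le> q" for v
    using ok[OF that] by (simp add: g_def)
  have hg: "branch_slope q v = (q - v) * g v" for v by (simp add: branch_slope_def g_def)
  have "continuous_on {p<..<q} (branch_slope q)"
    unfolding branch_slope_def[abs_def] energy_cofactor_def using ok by (intro continuous_intros) force+
  moreover have "g x > 0" using gpos x assms by auto
  moreover have "branch_slope q v > 0" if "p < v" "v < q" for v
    using gpos[of v] that by (simp add: hg)
  moreover have "branch_slope q v \<le> g x * (q - v)" if "v0 \<le> v" "v < q" for v
    using x(3)[of v] that by (simp add: hg mult.commute mult_right_mono)
  ultimately obtain \<delta> w where w: "\<delta> > 0" "w 0 = v0" "(w \<longlongrightarrow> q) at_top"
    "\<And>s. s > -\<delta> \<Longrightarrow> p < w s \<and> w s < q \<and> (w has_real_derivative branch_slope q (w s)) (at s)"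
    using autonomous_orbit_to_equilibrium[of p v0 q "branch_slope q" "g x"] assms by blast
  have "((\<lambda>s. branch_slope q (w s)) has_real_derivative
        ((w s)\<^sup>2 / 2 - w s - (q\<^sup>2 / 2 - q) - (branch_slope q (w s))\<^sup>2) / w s) (at s)" if "s > -\<delta>" for s
  proof -
    have "w s \<noteq> 0" "energy_cofactor q (w s) > 0" using w(4)[OF that] ok[of "w s"] by auto
    then obtain D where D: "(branch_slope q has_real_derivative D) (at (w s))"
      "D * branch_slope q (w s) = ((w s)\<^sup>2 / 2 - w s - (q\<^sup>2 / 2 - q) - (branch_slope q (w s))\<^sup>2) / w s"
      by (rule branch_slope_chain_rule)
    show ?thesis
      using DERIV_chain2[of "branch_slope q" D w s "branch_slope q (w s)" UNIV] D w(4)[OF that] by simp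
  qed
  moreover have "\<exists>N. \<forall>v\<in>{p..q}. \<bar>(q - v) * sqrt (energy_cofactor q v) / 2\<bar> \<le> N"
  proof -
    have "compact ((\<lambda>v. (q - v) * sqrt (energy_cofactor q v) / 2) ` {p..q})"
      unfolding energy_cofactor_def by (intro compact_continuous_image continuous_intros) auto
    then show ?thesis by (auto dest!: compact_imp_bounded simp: bounded_iff)
  qed
  then obtain N where N: "\<forall>v\<in>{p..q}. \<bar>(q - v) * sqrt (energy_cofactor q v) / 2\<bar> \<le> N" by blast
  have "\<bar>w s * branch_slope q (w s)\<bar> \<le> N" if "s > -\<delta>" for s
    using bspec[OF N, of "w s"] w(4)[OF that] ok[of "w s"] by (simp add: branch_slope_def abs_mult)
  ultimately show ?thesis using w that by blast
qed

section \<open>Convolution with the derivative of the kernel\<close>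

lemma exp_minus_integrable_half_line: "integrable lborel (\<lambda>y::real. indicator {x..} y * exp (x - y))"
proof -
  have "((\<lambda>y::real. exp (-1 * y)) has_integral exp (-1 * x) / 1) {x..}"
    by (rule has_integral_exp_minus_to_infinity) simp
  then have "(\<lambda>y::real. exp (- y)) absolutely_integrable_on {x..}"
    by (intro nonnegative_absolutely_integrable_1) (auto simp: integrable_on_def)
  then have "integrable lborel (\<lambda>y::real. indicator {x..} y * exp (- y))"
    by (simp add: set_integrable_def integrable_completion)
  from integrable_mult_right[OF this, of "exp x"] show ?thesis
    by (simp add: exp_diff exp_minus field_simps)
qed

text \<open>
  The integrand \<open>exp (x - y) * W y\<close> is the derivative of \<open>- exp (x - y) * (P y + P' y)\<close>, except at the
  point \<open>0\<close>, where this antiderivative is still continuous.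
\<close>

lemma laplace_half_line:
  fixes W P P' :: "real \<Rightarrow> real"
  assumes W[measurable]: "W \<in> borel_measurable borel" and bW: "\<And>y. \<bar>W y\<bar> \<le> M"
    and bP: "\<And>y. \<bar>P y\<bar> \<le> M" "\<And>y. \<bar>P' y\<bar> \<le> M"
    and P: "\<And>y. (P has_real_derivative P' y) (at y)" and P'c: "continuous_on UNIV P'"
    and P': "\<And>y. y \<noteq> 0 \<Longrightarrow> (P' has_real_derivative P y - W y) (at y)"
  shows "has_bochner_integral lborel (\<lambda>y. indicator {x..} y * (exp (x - y) * W y)) (P x + P' x)"
proof -
  let ?f = "\<lambda>y. indicator {x..} y * (exp (x - y) * W y)"
  have int: "integrable lborel ?f"
  proof (rule Bochner_Integration.integrable_bound)
    show "integrable lborel (\<lambda>y::real. (indicator {x..} y * exp (x - y)) * M)"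
      using exp_minus_integrable_half_line by (rule integrable_mult_left)
    show "AE y in lborel. norm (?f y) \<le> norm (indicator {x..} y * exp (x - y) * M)"
      using bW by (intro AE_I2) (auto simp: abs_mult indicator_def intro!: mult_left_mono order_trans[OF bW abs_ge_self])
  qed simp
  define \<Phi> where "\<Phi> y = - (exp (x - y) * (P y + P' y))" for y
  have Pc: "continuous_on UNIV P" using P by (intro continuous_at_imp_continuous_on) (auto intro: DERIV_isCont)
  have partial: "(\<integral>y. indicator {..n} y *\<^sub>R ?f y \<partial>lborel) = \<Phi> n - \<Phi> x" if "n \<ge> x" for n
  proof -
    have eq: "indicator {..n} y *\<^sub>R ?f y = indicator {x..n} y *\<^sub>R (exp (x - y) * W y)" for y
      by (auto simp: indicator_def)
    have "((\<lambda>y. exp (x - y) * W y) has_integral (\<Phi> n - \<Phi> x)) {x..n}"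
    proof (rule fundamental_theorem_of_calculus_interior_strong[where S = "{0}"])
      show "continuous_on {x..n} \<Phi>"
        unfolding \<Phi>_def[abs_def]
        by (intro continuous_intros continuous_on_subset[OF Pc] continuous_on_subset[OF P'c]) auto
      show "(\<Phi> has_vector_derivative exp (x - y) * W y) (at y)" if "y \<in> {x<..<n} - {0}" for y
        unfolding \<Phi>_def[abs_def] has_real_derivative_iff_has_vector_derivative[symmetric]
        using that by (auto intro!: derivative_eq_intros P P' simp: algebra_simps)
    qed (use that in auto)
    moreover have "set_integrable lborel {x..n} (\<lambda>y. exp (x - y) * W y)"
      unfolding set_integrable_def eq[symmetric] 
      by (intro integrable_mult_indicator[of "{..n}", simplified] int) auto
    ultimately have "(LINT y:{x..n}|lborel. exp (x - y) * W y) = \<Phi> n - \<Phi> x"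
      by (simp add: set_borel_integral_eq_integral(2) integral_unique)
    then show ?thesis
      unfolding eq set_lebesgue_integral_def .
  qed
  have "((\<lambda>n. \<integral>y. indicator {..n} y *\<^sub>R ?f y \<partial>lborel) \<longlongrightarrow> (\<integral>y. ?f y \<partial>lborel)) at_top"
    by (rule tendsto_integral_at_top[OF _ int]) simp
  moreover have lim\<Phi>: "((\<lambda>n. \<Phi> n - \<Phi> x) \<longlongrightarrow> 0 - \<Phi> x) at_top"
  proof (intro tendsto_intros)
    have "filterlim (\<lambda>n. x - n) at_bot at_top"
      unfolding filterlim_at_bot
    proof
      show "\<forall>\<^sub>F n in at_top. x - n \<le> Z" for Z
        using eventually_ge_at_top[of "x - Z"] by (rule eventually_mono) simp
    qed
    then have lim: "((\<lambda>n. exp (x - n) * (2 * M)) \<longlongrightarrow> 0) at_top"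
      by (intro tendsto_mult_left_zero filterlim_compose[OF exp_at_bot])
    show "(\<Phi> \<longlongrightarrow> 0) at_top"
    proof (rule Lim_null_comparison[OF _ lim])
      show "\<forall>\<^sub>F n in at_top. norm (\<Phi> n) \<le> exp (x - n) * (2 * M)"
        unfolding \<Phi>_def real_norm_def abs_minus_cancel abs_mult
      proof (intro always_eventually allI mult_mono)
        fix n show "\<bar>P n + P' n\<bar> \<le> 2 * M" using bP[of n] by linarith
      qed auto
    qed
  qed
  moreover have "((\<lambda>n. \<integral>y. indicator {..n} y *\<^sub>R ?f y \<partial>lborel) \<longlongrightarrow> 0 - \<Phi> x) at_top"
    by (rule Lim_transform_eventually[OF lim\<Phi> eventually_mono[OF eventually_ge_at_top[of x]]])
       (rule partial[symmetric])
  ultimately have "(\<integral>y. ?f y \<partial>lborel) = 0 - \<Phi> x"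
    by (intro tendsto_unique[OF trivial_limit_at_top_linorder])
  with int show ?thesis by (simp add: has_bochner_integral_iff \<Phi>_def)
qed

text \<open>
  The two half-line integrals against the exponential are \<open>P + P'\<close> on the right and, after the
  reflection of the line, \<open>P - P'\<close> on the left. Half their sum would be the convolution \<open>P\<close> of \<open>K\<close> with
  \<open>W\<close>; half their difference is its derivative. In this way the convolution never has to be
  differentiated under the integral sign.
\<close>

lemma convolution_kernel_deriv:
  fixes W P P' :: "real \<Rightarrow> real"
  assumes W[measurable]: "W \<in> borel_measurable borel" and bW: "\<And>y. \<bar>W y\<bar> \<le> M"
    and bP: "\<And>y. \<bar>P y\<bar> \<le> M" "\<And>y. \<bar>P' y\<bar> \<le> M"
    and P: "\<And>y. (P has_real_derivative P' y) (at y)" and P'c: "continuous_on UNIV P'"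
    and P': "\<And>y. y \<noteq> 0 \<Longrightarrow> (P' has_real_derivative P y - W y) (at y)"
  shows "has_bochner_integral lborel (\<lambda>y. kernel_deriv (x - y) * W y) (P' x)"
proof -
  have right: "has_bochner_integral lborel (\<lambda>y. indicator {x..} y * (exp (x - y) * W y)) (P x + P' x)"
    by (rule laplace_half_line[OF assms])
  have "has_bochner_integral lborel (\<lambda>y. indicator {-x..} y * (exp (- x - y) * W (- y))) (P (- (- x)) + - P' (- (- x)))"
  proof (rule laplace_half_line)
    show "((\<lambda>y. P (- y)) has_real_derivative - P' (- y)) (at y)" for y
      using DERIV_mirror[of P "P' (- y)" y] P[of "-y"] by simp
    show "((\<lambda>y. - P' (- y)) has_real_derivative P (- y) - W (- y)) (at y)" if "y \<noteq> 0" for y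
      using DERIV_minus[OF iffD1[OF DERIV_mirror P'[of "-y"]]] that by simp
    show "continuous_on UNIV (\<lambda>y. - P' (- y))"
      by (intro continuous_intros continuous_on_compose2[OF P'c]) auto
  qed (use bW bP in auto)
  from lborel_has_bochner_integral_real_affine_iff[THEN iffD1, of "-1" _ _ 0, OF _ this]
  have left: "has_bochner_integral lborel (\<lambda>y. indicator {..x} y * (exp (y - x) * W y)) (P x - P' x)"
    by (simp add: indicator_def algebra_simps)
  have "has_bochner_integral lborel (\<lambda>y. (indicator {x..} y * (exp (x - y) * W y) - indicator {..x} y * (exp (y - x) * W y)) / 2)
     (((P x + P' x) - (P x - P' x)) / 2)"
    by (intro has_bochner_integral_divide has_bochner_integral_diff left right)
  \<comment> \<open>At \<open>y = x\<close> the two terms cancel, in accordance with \<open>sgn 0 = 0\<close>.\<close>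
  moreover have "(indicator {x..} y * (exp (x - y) * W y) - indicator {..x} y * (exp (y - x) * W y)) / 2
      = kernel_deriv (x - y) * W y" for y
    by (auto simp: kernel_deriv_def indicator_def sgn_if)
  ultimately show ?thesis by simp
qed

section \<open>The weak formulation\<close>

text \<open>
  The partial derivatives inherit the support of \<open>\<phi>\<close>: off the support \<open>\<phi>\<close> vanishes on an open set,
  and on a ball containing it continuity gives the bounds.
\<close>

lemma test_function_calculus:
  fixes \<phi> :: "real \<times> real \<Rightarrow> real"
  assumes "test_function \<phi>"
  obtains \<phi>x \<phi>t r N where 
    "continuous_on UNIV \<phi>" "continuous_on UNIV \<phi>x" "continuous_on UNIV \<phi>t"
    "\<And>p. (\<phi> has_derivative (\<lambda>v. fst v * \<phi>x p + snd v * \<phi>t p)) (at p)"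
    "\<And>p. norm p > r \<Longrightarrow> \<phi> p = 0 \<and> \<phi>x p = 0 \<and> \<phi>t p = 0"
    "\<And>p. \<bar>\<phi> p\<bar> \<le> N \<and> \<bar>\<phi>x p\<bar> \<le> N \<and> \<bar>\<phi>t p\<bar> \<le> N" "r > 0"
proof -
  define D where "D p = frechet_derivative \<phi> (at p)" for p
  have C1: "Ck_on 1 \<phi> UNIV" and supp: "compact (closure {p. \<phi> p \<noteq> 0})"
    using assms by (auto simp: test_function_def)
  have diff: "\<phi> differentiable (at p)" for p using C1 by (cases p) simp
  have Dc: "continuous_on UNIV (\<lambda>p. D p v)" for v using C1 by (cases v) (simp add: D_def)
  have D: "(\<phi> has_derivative D p) (at p)" for p
    using diff[of p] by (simp add: D_def frechet_derivative_works)
  define \<phi>x where "\<phi>x p = D p (1, 0)" for p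
  define \<phi>t where "\<phi>t p = D p (0, 1)" for p
  have Deq: "D p = (\<lambda>v. fst v * \<phi>x p + snd v * \<phi>t p)" for p
  proof
    fix v
    have lin: "linear (D p)" using D by (rule has_derivative_linear)
    have "v = fst v *\<^sub>R (1, 0) + snd v *\<^sub>R (0, 1)" by (cases v) simp
    then have "D p v = D p (fst v *\<^sub>R (1, 0) + snd v *\<^sub>R (0, 1))" by simp
    also have "\<dots> = fst v * \<phi>x p + snd v * \<phi>t p"
      by (simp only: linear_add[OF lin] linear_scale[OF lin] \<phi>x_def \<phi>t_def real_scaleR_def)
    finally show "D p v = fst v * \<phi>x p + snd v * \<phi>t p" .
  qed
  have cont: "continuous_on UNIV \<phi>" "continuous_on UNIV \<phi>x" "continuous_on UNIV \<phi>t"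
    using D Dc unfolding \<phi>x_def[abs_def] \<phi>t_def[abs_def]
    by (auto intro!: continuous_at_imp_continuous_on has_derivative_continuous)
  obtain r where r: "r > 0" "\<And>p. p \<in> closure {p. \<phi> p \<noteq> 0} \<Longrightarrow> norm p \<le> r"
    using compact_imp_bounded[OF supp] by (meson bounded_pos)
  have zero: "\<phi> p = 0 \<and> \<phi>x p = 0 \<and> \<phi>t p = 0" if "norm p > r" for p
  proof -
    have z: "\<phi> p = 0" if "norm p > r" for p
      using r(2)[of p] closure_subset[of "{p. \<phi> p \<noteq> 0}"] that by force
    have "open {p :: real \<times> real. norm p > r}"
      by (intro open_Collect_less continuous_intros)
    then have "(\<phi> has_derivative (\<lambda>v. 0)) (at p)"
      using z that by (intro has_derivative_transform_within_open[OF has_derivative_const[of 0]]) auto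
    then have "D p = (\<lambda>v. 0)" using D has_derivative_unique by blast
    then show ?thesis using z[OF that] by (simp add: \<phi>x_def \<phi>t_def)
  qed
  have bd: "\<exists>N. \<forall>p. \<bar>f p\<bar> \<le> N" if "continuous_on UNIV f" "\<And>p. norm p > r \<Longrightarrow> f p = 0" 
    for f :: "real \<times> real \<Rightarrow> real"
  proof -
    have "compact (f ` cball 0 r)"
      using that by (intro compact_continuous_image continuous_on_subset[OF that(1)]) auto
    then obtain N where "\<forall>x\<in>cball 0 r. \<bar>f x\<bar> \<le> N"
      by (auto dest!: compact_imp_bounded simp: bounded_iff)
    then have N: "\<And>p. norm p \<le> r \<Longrightarrow> \<bar>f p\<bar> \<le> N" by simp
    have "\<bar>f p\<bar> \<le> max N 0" for p
      using N[of p] that(2)[of p] by (cases "norm p \<le> r") auto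
    then show ?thesis by blast
  qed
  obtain N1 N2 N3 where N: "\<forall>p. \<bar>\<phi> p\<bar> \<le> N1" "\<forall>p. \<bar>\<phi>x p\<bar> \<le> N2" "\<forall>p. \<bar>\<phi>t p\<bar> \<le> N3"
    using bd[OF cont(1)] bd[OF cont(2)] bd[OF cont(3)] zero by blast
  show ?thesis
  proof (rule that[of \<phi>x \<phi>t r "max N1 (max N2 N3)"])
    show "\<bar>\<phi> p\<bar> \<le> max N1 (max N2 N3) \<and> \<bar>\<phi>x p\<bar> \<le> max N1 (max N2 N3) \<and> \<bar>\<phi>t p\<bar> \<le> max N1 (max N2 N3)" for p
      using N[rule_format, of p] by (auto simp: le_max_iff_disj)
    show "(\<phi> has_derivative (\<lambda>v. fst v * \<phi>x p + snd v * \<phi>t p)) (at p)" for p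
      using D[of p] by (simp add: Deq)
  qed (use cont zero r in auto)
qed

lemma integrable_bounded_support:
  fixes f :: "'a::euclidean_space \<Rightarrow> real"
  assumes "f \<in> borel_measurable borel" "\<And>p. \<bar>f p\<bar> \<le> N" "\<And>p. norm p > r \<Longrightarrow> f p = 0"
  shows "integrable lborel f"
proof (rule integrableI_bounded_set[where A = "cball 0 r" and B = N])
  show "emeasure lborel (cball 0 r :: 'a set) < \<infinity>"
    by (intro emeasure_bounded_finite) auto
qed (use assms in auto)

lemma integral_derivative_bounded_support:
  fixes F f :: "real \<Rightarrow> real"
  assumes F: "\<And>x. (F has_real_derivative f x) (at x)" and "continuous_on UNIV f"
    and F0: "\<And>x. \<bar>x\<bar> > r \<Longrightarrow> F x = 0" and f0: "\<And>x. \<bar>x\<bar> > r \<Longrightarrow> f x = 0"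
  shows "has_bochner_integral lborel f 0"
    and "has_bochner_integral lborel (\<lambda>x. indicator {0..} x * f x) (- F 0)"
proof -
  define s where "s = \<bar>r\<bar> + 1"
  have c: "isCont f x" for x using assms(2) by (simp add: continuous_on_eq_continuous_at)
  have Fs: "F s = 0" "F (-s) = 0" using F0 by (auto simp: s_def)
  have "has_bochner_integral lborel (\<lambda>x. f x * indicator {-s..s} x) (F s - F (-s))"
    by (rule has_bochner_integral_FTC_Icc_real) (use F c in \<open>auto simp: s_def\<close>)
  moreover have "f x * indicator {-s..s} x = f x" for x
    using f0[of x] by (cases "\<bar>x\<bar> > r") (auto simp: indicator_def s_def)
  ultimately show "has_bochner_integral lborel f 0" by (simp add: Fs)
  have "has_bochner_integral lborel (\<lambda>x. f x * indicator {0..s} x) (F s - F 0)"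
    by (rule has_bochner_integral_FTC_Icc_real) (use F c in \<open>auto simp: s_def\<close>)
  moreover have "f x * indicator {0..s} x = indicator {0..} x * f x" for x
    using f0[of x] by (cases "\<bar>x\<bar> > r") (auto simp: indicator_def s_def)
  ultimately show "has_bochner_integral lborel (\<lambda>x. indicator {0..} x * f x) (- F 0)" by (simp add: Fs)
qed

lemma Linf_loc_bounded:
  assumes [measurable]: "f \<in> borel_measurable borel" "S \<in> sets borel" and "\<And>p. \<bar>f p\<bar> \<le> M"
  shows "Linf_loc S f"
proof -
  have "(\<lambda>p. indicator S p *\<^sub>R f p) \<in> borel_measurable lborel" by simp
  then have "(\<lambda>p. indicator S p *\<^sub>R f p) \<in> borel_measurable lebesgue"
    by (rule measurable_completion)
  then show ?thesis
    using assms(3) by (auto simp: Linf_loc_def set_borel_measurable_def)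
qed

text \<open>
  Subtracting the exact \<open>x\<close>-derivative of \<open>(P (x - c * t) - E) * \<phi>\<close>, whose integral vanishes, and using the
  energy relation, the weak integrand becomes \<open>- W (x - c * t) * (c * \<phi>x + \<phi>t)\<close>. In the moving
  coordinate \<open>\<xi> = x - c * t\<close> the bracket is a pure \<open>t\<close>-derivative while \<open>W \<xi>\<close> does not depend on \<open>t\<close>, so
  Fubini's theorem and the fundamental theorem of calculus leave the initial term.
  The jump condition is contained in the energy relation, because \<open>P\<close> is continuous.
\<close>

lemma weak_solution_of_profile:
  fixes W P P' :: "real \<Rightarrow> real" and c E M :: real
  assumes W[measurable]: "W \<in> borel_measurable borel" and bW: "\<And>y. \<bar>W y\<bar> \<le> M"
    and bP: "\<And>y. \<bar>P y\<bar> \<le> M" "\<And>y. \<bar>P' y\<bar> \<le> M"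
    and P: "\<And>y. (P has_real_derivative P' y) (at y)" and P'c: "continuous_on UNIV P'"
    and P': "\<And>y. y \<noteq> 0 \<Longrightarrow> (P' has_real_derivative P y - W y) (at y)"
    and E: "\<And>y. (W y)\<^sup>2 / 2 - c * W y + P y = E"
  shows "FW_weak_solution (\<lambda>x t. W (x - c * t)) W"
proof -
  have conv: "has_bochner_integral lborel (\<lambda>y. kernel_deriv (x - y) * W (y - c * t)) (P' (x - c * t))" for x t
  proof -
    have "has_bochner_integral lborel (\<lambda>y. kernel_deriv (x - c * t - y) * W y) (P' (x - c * t))"
      by (rule convolution_kernel_deriv[OF assms(1-7)])
    from lborel_has_bochner_integral_real_affine_iff[THEN iffD1, of 1 _ _ "- c * t", OF _ this]
    show ?thesis by (simp add: algebra_simps)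
  qed
  have kmeas[measurable]: "kernel_deriv \<in> borel_measurable borel"
    unfolding kernel_deriv_def[abs_def] by measurable
  have conv_int: "integrable lebesgue (\<lambda>y. kernel_deriv (x - y) * W (y - c * t))" for x t
    using conv[of x t] by (subst integrable_completion) (auto simp: has_bochner_integral_iff)
  have conv_eq: "convolution kernel_deriv (\<lambda>y. W (y - c * t)) x = P' (x - c * t)" for x t
    unfolding convolution_def
    using conv[of x t] by (subst integral_completion) (auto simp: has_bochner_integral_iff)
  have [measurable]: "P \<in> borel_measurable borel" "P' \<in> borel_measurable borel"
    using P P'c by (auto intro!: borel_measurable_continuous_onI continuous_at_imp_continuous_on intro: DERIV_isCont)
  have weak: "set_integrable lebesgue (UNIV \<times> {0..}) (\<lambda>(x, t). weak_integrand (\<lambda>x t. W (x - c * t)) \<phi> x t) \<and>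
        (LINT t:{0..}|lebesgue. (LINT x|lebesgue. weak_integrand (\<lambda>x t. W (x - c * t)) \<phi> x t))
          = (LINT x|lebesgue. W x * \<phi> (x, 0))" if "test_function \<phi>" for \<phi>
  proof -
    obtain \<phi>x \<phi>t r N where cont: "continuous_on UNIV \<phi>" "continuous_on UNIV \<phi>x" "continuous_on UNIV \<phi>t"
      and der: "\<And>p. (\<phi> has_derivative (\<lambda>v. fst v * \<phi>x p + snd v * \<phi>t p)) (at p)"
      and zero: "\<And>p. norm p > r \<Longrightarrow> \<phi> p = 0 \<and> \<phi>x p = 0 \<and> \<phi>t p = 0"
      and bd: "\<And>p. \<bar>\<phi> p\<bar> \<le> N \<and> \<bar>\<phi>x p\<bar> \<le> N \<and> \<bar>\<phi>t p\<bar> \<le> N" and "r > 0"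
      using test_function_calculus[OF \<open>test_function \<phi>\<close>] by blast
    have [measurable]: "\<phi> \<in> borel_measurable borel" "\<phi>x \<in> borel_measurable borel" "\<phi>t \<in> borel_measurable borel"
      using cont by (auto intro!: borel_measurable_continuous_onI)
    have zero1: "\<phi> (x, t) = 0 \<and> \<phi>x (x, t) = 0 \<and> \<phi>t (x, t) = 0" if "\<bar>x\<bar> > r \<or> \<bar>t\<bar> > r" for x t
      using zero[of "(x, t)"] that norm_fst_le[of x t] norm_snd_le[of t x] by auto
    have line: "((\<lambda>s. \<phi> (a + b * s, d + e * s)) has_real_derivative
        b * \<phi>x (a + b * s, d + e * s) + e * \<phi>t (a + b * s, d + e * s)) (at s)" for a b d e s
    proof -
      have "((\<lambda>s. (a + b * s, d + e * s)) has_derivative (\<lambda>h. (b * h, e * h))) (at s)"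
        by (auto intro!: derivative_eq_intros)
      from has_derivative_compose[OF this der] show ?thesis
        unfolding has_field_derivative_def by (rule has_derivative_eq_rhs) (auto simp: algebra_simps)
    qed
    have dx: "((\<lambda>y. \<phi> (y, t)) has_real_derivative \<phi>x (x, t)) (at x)" for x t
      using line[of 0 1 t 0 x] by simp
    have dt: "((\<lambda>s. \<phi> (x, s)) has_real_derivative \<phi>t (x, t)) (at t)" for x t
      using line[of x 0 0 1 t] by simp
    define g where "g x t = - W (x - c * t) * \<phi>t (x, t) - (W (x - c * t))\<^sup>2 / 2 * \<phi>x (x, t)
        + P' (x - c * t) * \<phi> (x, t)" for x t
    have g: "weak_integrand (\<lambda>x t. W (x - c * t)) \<phi> x t = g x t" for x t
      unfolding weak_integrand_def g_def conv_eq using DERIV_imp_deriv[OF dx] DERIV_imp_deriv[OF dt] by simp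
    have gm[measurable]: "(\<lambda>(x, t). g x t) \<in> borel_measurable borel"
      unfolding g_def borel_prod[symmetric] by measurable
    have "0 \<le> N" "0 \<le> M" using bd[of 0] bW[of 0] by linarith+
    have gb: "\<bar>g x t\<bar> \<le> M * N + M\<^sup>2 / 2 * N + M * N" for x t
    proof -
      have "(W (x - c * t))\<^sup>2 \<le> M\<^sup>2" using bW by (metis abs_le_square_iff abs_of_nonneg \<open>0 \<le> M\<close>)
      then have "\<bar>W (x - c * t) * \<phi>t (x, t)\<bar> \<le> M * N" "\<bar>(W (x - c * t))\<^sup>2 / 2 * \<phi>x (x, t)\<bar> \<le> M\<^sup>2 / 2 * N"
        "\<bar>P' (x - c * t) * \<phi> (x, t)\<bar> \<le> M * N"
        unfolding abs_mult using bW bP bd \<open>0 \<le> N\<close> \<open>0 \<le> M\<close> by (intro mult_mono; simp)+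
      then show ?thesis unfolding g_def by linarith
    qed
    have gint: "integrable lborel (\<lambda>(x, t). g x t)"
    proof (rule integrable_bounded_support[OF gm, where r = r])
      show "\<bar>case p of (x, t) \<Rightarrow> g x t\<bar> \<le> M * N + M\<^sup>2 / 2 * N + M * N" for p
        using gb by (cases p) simp
    qed (use zero in \<open>auto simp: g_def\<close>)
    have "integrable lborel (\<lambda>p. indicator (UNIV \<times> {0..}) p *\<^sub>R (case p of (x, t) \<Rightarrow> g x t))"
      by (intro integrable_mult_indicator gint) (auto intro!: borel_closed closed_Times)
    then have A: "set_integrable lebesgue (UNIV \<times> {0..}) (\<lambda>(x, t). g x t)"
      unfolding set_integrable_def by (subst integrable_completion) (auto dest: borel_measurable_integrable)
    \<comment> \<open>The test function in the frame moving with the wave, and its \<open>t\<close>-derivative there.\<close>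
    define \<psi> where "\<psi> \<xi> t = \<phi> (\<xi> + c * t, t)" for \<xi> t
    define \<psi>t where "\<psi>t \<xi> t = c * \<phi>x (\<xi> + c * t, t) + \<phi>t (\<xi> + c * t, t)" for \<xi> t
    have d\<psi>: "(\<psi> \<xi> has_real_derivative \<psi>t \<xi> t) (at t)" for \<xi> t
      using line[of \<xi> c 0 1 t] by (simp add: \<psi>_def[abs_def] \<psi>t_def)
    have inner: "(LINT x|lebesgue. g x t) = (LINT \<xi>|lborel. - W \<xi> * \<psi>t \<xi> t)" for t
    proof -
      \<comment> \<open>The exact \<open>x\<close>-derivative that absorbs the flux and the convolution term.\<close>
      define q where "q x = P' (x - c * t) * \<phi> (x, t) + (P (x - c * t) - E) * \<phi>x (x, t)" for x
      have q: "has_bochner_integral lborel q 0"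
      proof (rule integral_derivative_bounded_support(1)[where F = "\<lambda>x. (P (x - c * t) - E) * \<phi> (x, t)" and r = r])
        show "((\<lambda>x. (P (x - c * t) - E) * \<phi> (x, t)) has_real_derivative q x) (at x)" for x
          unfolding q_def
          by (auto intro!: derivative_eq_intros DERIV_chain2[OF P] dx)
        have "continuous_on UNIV P" using P by (intro continuous_at_imp_continuous_on) (auto intro: DERIV_isCont)
        then show "continuous_on UNIV q"
          unfolding q_def[abs_def] using P'c cont
          by (intro continuous_intros) (auto intro!: continuous_intros elim!: continuous_on_compose2)
      qed (use zero1 in \<open>auto simp: q_def\<close>)
      have eq: "g x t = q x - W (x - c * t) * (c * \<phi>x (x, t) + \<phi>t (x, t))" for x
      proof -
        have "(W (x - c * t))\<^sup>2 / 2 = E + c * W (x - c * t) - P (x - c * t)"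
          using E[of "x - c * t"] by simp
        then show ?thesis by (simp only: g_def q_def) (simp add: algebra_simps)
      qed
      have gm': "(\<lambda>x. g x t) \<in> borel_measurable borel" unfolding g_def by measurable
      have gi: "integrable lborel (\<lambda>x. g x t)"
        using gb zero1 by (intro integrable_bounded_support[OF gm', where r = r]) (auto simp: g_def)
      have "(LINT x|lebesgue. g x t) = (LINT x|lborel. g x t)"
        using gm' by (subst integral_completion) auto
      also have "\<dots> = (LINT x|lborel. g x t - q x)"
        using q gi by (simp add: has_bochner_integral_iff)
      also have "\<dots> = (LINT x|lborel. - W (x - c * t) * (c * \<phi>x (x, t) + \<phi>t (x, t)))"
        by (simp add: eq)
      also have "\<dots> = (LINT \<xi>|lborel. - W \<xi> * \<psi>t \<xi> t)"
        by (subst lborel_integral_real_affine[of 1 _ "c * t"]) (auto simp: \<psi>t_def algebra_simps)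
      finally show ?thesis .
    qed
    define G where "G \<xi> t = indicator {0..} t * (- W \<xi> * \<psi>t \<xi> t)" for \<xi> t :: real
    have Gm: "(\<lambda>(\<xi>, t). G \<xi> t) \<in> borel_measurable borel"
      unfolding G_def \<psi>t_def borel_prod[symmetric] by measurable
    \<comment> \<open>For \<open>\<bar>t\<bar> \<le> r\<close> the moving frame is displaced by at most \<open>\<bar>c\<bar> * r\<close>.\<close>
    have \<psi>z: "\<psi> \<xi> t = 0 \<and> \<psi>t \<xi> t = 0" if "\<bar>\<xi>\<bar> > r + \<bar>c\<bar> * r \<or> \<bar>t\<bar> > r" for \<xi> t
    proof -
      have "\<bar>\<xi> + c * t\<bar> > r \<or> \<bar>t\<bar> > r"
      proof (rule ccontr)
        assume "\<not> ?thesis"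
        then have "\<bar>\<xi> + c * t\<bar> \<le> r" "\<bar>c\<bar> * \<bar>t\<bar> \<le> \<bar>c\<bar> * r" "\<bar>t\<bar> \<le> r" by (auto intro: mult_left_mono)
        then show False using that abs_triangle_ineq[of "\<xi> + c * t" "- (c * t)"] by (auto simp: abs_mult)
      qed
      from zero1[OF this] show ?thesis by (simp add: \<psi>_def \<psi>t_def)
    qed
    have Gint: "integrable (lborel \<Otimes>\<^sub>M lborel) (\<lambda>(\<xi>, t). G \<xi> t)"
      unfolding lborel_prod
    proof (rule integrable_bounded_support[OF Gm, where r = "(r + \<bar>c\<bar> * r) + r"])
      show "\<bar>case p of (\<xi>, t) \<Rightarrow> G \<xi> t\<bar> \<le> M * (\<bar>c\<bar> * N + N)" for p
      proof (cases p)
        case (Pair \<xi> t)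
        have "\<bar>c * \<phi>x (\<xi> + c * t, t)\<bar> \<le> \<bar>c\<bar> * N" unfolding abs_mult using bd by (intro mult_left_mono) auto
        moreover have "\<bar>\<phi>t (\<xi> + c * t, t)\<bar> \<le> N" using bd by simp
        ultimately have "\<bar>\<psi>t \<xi> t\<bar> \<le> \<bar>c\<bar> * N + N" unfolding \<psi>t_def by linarith
        then have "\<bar>W \<xi>\<bar> * \<bar>\<psi>t \<xi> t\<bar> \<le> M * (\<bar>c\<bar> * N + N)"
          using bW \<open>0 \<le> M\<close> by (intro mult_mono) auto
        moreover have "0 \<le> M * (\<bar>c\<bar> * N + N)" using \<open>0 \<le> M\<close> \<open>0 \<le> N\<close> by auto
        ultimately show ?thesis by (auto simp: Pair G_def abs_mult indicator_def)
      qed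
      show "(case p of (\<xi>, t) \<Rightarrow> G \<xi> t) = 0" if "r + \<bar>c\<bar> * r + r < norm p" for p
      proof (cases p)
        case (Pair \<xi> t)
        have "norm p \<le> \<bar>\<xi>\<bar> + \<bar>t\<bar>" using norm_Pair_le[of \<xi> t] Pair by simp
        then have "\<bar>\<xi>\<bar> > r + \<bar>c\<bar> * r \<or> \<bar>t\<bar> > r" using that by linarith
        then show ?thesis using \<psi>z by (simp add: Pair G_def)
      qed
    qed
    have \<psi>tc: "continuous_on UNIV (\<psi>t \<xi>)" for \<xi>
      unfolding \<psi>t_def[abs_def]
      by (intro continuous_intros continuous_on_compose2[OF cont(2)] continuous_on_compose2[OF cont(3)]) auto
    have Gt: "(LINT t|lborel. G \<xi> t) = W \<xi> * \<phi> (\<xi>, 0)" for \<xi>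
    proof -
      have "has_bochner_integral lborel (\<lambda>t. indicator {0..} t * \<psi>t \<xi> t) (- \<psi> \<xi> 0)"
        by (rule integral_derivative_bounded_support(2)[OF d\<psi> \<psi>tc, where r = r]) (use \<psi>z in auto)
      from has_bochner_integral_mult_right[OF this, of "- W \<xi>"]
      show ?thesis by (simp add: has_bochner_integral_iff G_def \<psi>_def mult_ac)
    qed
    have inner_m: "(\<lambda>t. indicator {0..} t *\<^sub>R (LINT \<xi>|lborel. - W \<xi> * \<psi>t \<xi> t)) \<in> borel_measurable lborel"
      unfolding \<psi>t_def by measurable
    have "(LINT t:{0..}|lebesgue. (LINT x|lebesgue. g x t)) = (LINT t|lborel. (LINT \<xi>|lborel. G \<xi> t))"
      unfolding inner set_lebesgue_integral_def using inner_m
      by (subst integral_completion) (auto simp: G_def)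
    also have "\<dots> = (LINT \<xi>|lborel. (LINT t|lborel. G \<xi> t))"
      by (rule lborel_pair.Fubini_integral[OF Gint])
    also have "\<dots> = (LINT \<xi>|lborel. W \<xi> * \<phi> (\<xi>, 0))" by (simp add: Gt)
    also have "\<dots> = (LINT \<xi>|lebesgue. W \<xi> * \<phi> (\<xi>, 0))"
      by (subst integral_completion) auto
    finally show ?thesis using A by (simp add: g)
  qed
  have "Linf_loc (UNIV \<times> {0..}) (\<lambda>(x, t). W (x - c * t))"
  proof (rule Linf_loc_bounded)
    show "(\<lambda>(x, t). W (x - c * t)) \<in> borel_measurable borel"
      unfolding borel_prod[symmetric] by measurable
  qed (use bW in \<open>auto intro!: borel_closed closed_Times\<close>)
  moreover have "Linf_loc UNIV W" using bW by (intro Linf_loc_bounded) auto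
  ultimately show ?thesis
    unfolding FW_weak_solution_def using conv_int weak by (simp add: case_prod_beta)
qed

section \<open>Gluing two branches at a jump\<close>

lemma Ck_on_2I:
  fixes f :: "real \<Rightarrow> real"
  assumes "open S" and f1: "\<And>x. x \<in> S \<Longrightarrow> (f has_real_derivative f1 x) (at x)"
    and f2: "\<And>x. x \<in> S \<Longrightarrow> (f1 has_real_derivative f2 x) (at x)" and "continuous_on S f2"
  shows "Ck_on 2 f S"
proof -
  have D1: "frechet_derivative f (at x) v = f1 x * v" if "x \<in> S" for x v
    using frechet_derivative_at[OF f1[OF that, unfolded has_field_derivative_def]] by metis
  have d2: "((\<lambda>x. frechet_derivative f (at x) v) has_derivative (\<lambda>k. f2 x * v * k)) (at x)" if "x \<in> S" for x v
  proof (rule has_derivative_transform_within_open[OF _ \<open>open S\<close> that])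
    have "((\<lambda>x. f1 x * v) has_real_derivative f2 x * v) (at x)"
      using f2[OF that] by (auto intro!: derivative_eq_intros)
    then show "((\<lambda>x. f1 x * v) has_derivative (\<lambda>k. f2 x * v * k)) (at x)"
      by (simp add: has_field_derivative_def)
  qed (simp add: D1)
  have D2: "frechet_derivative (\<lambda>x. frechet_derivative f (at x) v) (at x) k = f2 x * v * k" if "x \<in> S" for x v k
    using frechet_derivative_at[OF d2[OF that]] by metis
  have "continuous_on S (\<lambda>x. frechet_derivative (\<lambda>x. frechet_derivative f (at x) v) (at x) k)" for v k
    using \<open>continuous_on S f2\<close> by (subst continuous_on_cong[OF refl D2]) (auto intro!: continuous_intros)
  moreover have "f differentiable (at x)" if "x \<in> S" for x
    using f1[OF that] unfolding has_field_derivative_def by (rule differentiableI)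
  moreover have "(\<lambda>x. frechet_derivative f (at x) v) differentiable (at x)" if "x \<in> S" for x v
    using d2[OF that] by (rule differentiableI)
  ultimately show ?thesis by (simp add: numeral_2_eq_2)
qed

lemma tendsto_glue:
  fixes u v :: "real \<Rightarrow> real"
  assumes "isCont u 0" "isCont v 0"
  shows "((\<lambda>x. if x < 0 then u x else v x) \<longlongrightarrow> u 0) (at_left 0)"
    and "((\<lambda>x. if x < 0 then u x else v x) \<longlongrightarrow> v 0) (at_right 0)"
proof -
  have "(u \<longlongrightarrow> u 0) (at_left 0)" "(v \<longlongrightarrow> v 0) (at_right 0)"
    using assms by (simp_all add: isCont_def filterlim_at_split)
  then show "((\<lambda>x. if x < 0 then u x else v x) \<longlongrightarrow> u 0) (at_left 0)"
    and "((\<lambda>x. if x < 0 then u x else v x) \<longlongrightarrow> v 0) (at_right 0)"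
    by (auto elim!: Lim_transform_eventually simp: eventually_at_filter)
qed

lemma has_real_derivative_glue:
  fixes u v :: "real \<Rightarrow> real"
  assumes "(u has_real_derivative d) (at 0)" "(v has_real_derivative d) (at 0)" "u 0 = v 0"
  shows "((\<lambda>x. if x < 0 then u x else v x) has_real_derivative d) (at 0)"
proof -
  have "((\<lambda>y. (u y - u 0) / (y - 0)) \<longlongrightarrow> d) (at_left 0)" "((\<lambda>y. (v y - v 0) / (y - 0)) \<longlongrightarrow> d) (at_right 0)"
    using assms(1,2) by (simp_all add: has_field_derivative_iff filterlim_at_split)
  then show ?thesis
    unfolding has_field_derivative_iff filterlim_at_split using assms(3)
    by (auto elim!: Lim_transform_eventually simp: eventually_at_filter)
qed

lemma has_real_derivative_if_sign:
  fixes u v :: "real \<Rightarrow> real"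
  assumes "x \<noteq> 0" "x < 0 \<Longrightarrow> (u has_real_derivative d) (at x)" "x > 0 \<Longrightarrow> (v has_real_derivative e) (at x)"
  shows "((\<lambda>x. if x < 0 then u x else v x) has_real_derivative (if x < 0 then d else e)) (at x)"
proof (cases "x < 0")
  case True
  have "((\<lambda>x. if x < 0 then u x else v x) has_real_derivative d) (at x)"
    using assms(2)[OF True]
    by (rule has_field_derivative_transform_within_open[where S = "{..<0}"]) (use True in auto)
  with True show ?thesis by simp
next
  case False
  then have "x > 0" using assms(1) by simp
  have "((\<lambda>x. if x < 0 then u x else v x) has_real_derivative e) (at x)"
    using assms(3)[OF \<open>x > 0\<close>]
    by (rule has_field_derivative_transform_within_open[where S = "{0<..}"]) (use \<open>x > 0\<close> in auto)
  with False show ?thesis by simp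
qed

text \<open>
  Both pieces are assumed to be defined a little beyond \<open>0\<close>, so that the one-sided limits of the
  profile and of its derivatives are simply the values of the pieces at \<open>0\<close>.
\<close>

lemma profile_function_glue:
  fixes u v :: "real \<Rightarrow> real"
  assumes "\<delta> > 0"
    and u: "\<And>x. x < \<delta> \<Longrightarrow> (u has_real_derivative u1 x) (at x)"
      "\<And>x. x < \<delta> \<Longrightarrow> (u1 has_real_derivative u2 x) (at x)" "\<And>x. x < \<delta> \<Longrightarrow> isCont u2 x"
    and v: "\<And>x. x > -\<delta> \<Longrightarrow> (v has_real_derivative v1 x) (at x)"
      "\<And>x. x > -\<delta> \<Longrightarrow> (v1 has_real_derivative v2 x) (at x)" "\<And>x. x > -\<delta> \<Longrightarrow> isCont v2 x"
    and lim: "(u \<longlongrightarrow> a) at_bot" "(v \<longlongrightarrow> b) at_top"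
  defines "W \<equiv> \<lambda>x. if x < 0 then u x else v x"
  shows "profile_function W" and "(W \<longlongrightarrow> a) at_bot" and "(W \<longlongrightarrow> b) at_top"
    and "(W \<longlongrightarrow> u 0) (at_left 0)" and "(W \<longlongrightarrow> v 0) (at_right 0)"
    and "W \<in> borel_measurable borel"
proof -
  define W1 where "W1 x = (if x < 0 then u1 x else v1 x)" for x
  define W2 where "W2 x = (if x < 0 then u2 x else v2 x)" for x
  have W1: "(W has_real_derivative W1 x) (at x)" if "x \<noteq> 0" for x
    using that \<open>\<delta> > 0\<close> u(1)[of x] v(1)[of x] unfolding W_def W1_def
    by (intro has_real_derivative_if_sign) auto
  have W2: "(W1 has_real_derivative W2 x) (at x)" if "x \<noteq> 0" for x
    using that \<open>\<delta> > 0\<close> u(2)[of x] v(2)[of x] unfolding W1_def[abs_def] W2_def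
    by (intro has_real_derivative_if_sign) auto
  have W2c: "isCont W2 x" if "x \<noteq> 0" for x
  proof (cases "x < 0")
    case True
    have "eventually (\<lambda>y. W2 y = u2 y) (nhds x)"
      using True by (intro eventually_mono[OF eventually_nhds_in_open[of "{..<0}"]]) (auto simp: W2_def)
    then show ?thesis using u(3)[of x] True \<open>\<delta> > 0\<close> isCont_cong by fastforce
  next
    case False
    then have "eventually (\<lambda>y. W2 y = v2 y) (nhds x)"
      using that by (intro eventually_mono[OF eventually_nhds_in_open[of "{0<..}"]]) (auto simp: W2_def)
    then show ?thesis using v(3)[of x] False \<open>\<delta> > 0\<close> isCont_cong by fastforce
  qed
  have "Ck_on 2 W (- {0})"
    by (rule Ck_on_2I[where ?f1.0 = W1 and ?f2.0 = W2])
       (use W1 W2 W2c in \<open>auto intro!: continuous_at_imp_continuous_on\<close>)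
  have dW: "deriv W x = W1 x" if "x \<noteq> 0" for x using W1[OF that] by (rule DERIV_imp_deriv)
  have ddW: "deriv (deriv W) x = W2 x" if "x \<noteq> 0" for x
  proof (rule DERIV_imp_deriv)
    show "(deriv W has_real_derivative W2 x) (at x)"
      using W2[OF that] by (rule has_field_derivative_transform_within_open[where S = "- {0}"])
        (use that dW in auto)
  qed
  have cont0: "isCont u 0" "isCont u1 0" "isCont u2 0" "isCont v 0" "isCont v1 0" "isCont v2 0"
    using DERIV_isCont[OF u(1)[of 0]] DERIV_isCont[OF u(2)[of 0]] u(3)[of 0]
      DERIV_isCont[OF v(1)[of 0]] DERIV_isCont[OF v(2)[of 0]] v(3)[of 0] \<open>\<delta> > 0\<close> by auto
  have lims: "(W \<longlongrightarrow> u 0) (at_left 0)" "(W \<longlongrightarrow> v 0) (at_right 0)"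
    "(W1 \<longlongrightarrow> u1 0) (at_left 0)" "(W1 \<longlongrightarrow> v1 0) (at_right 0)"
    "(W2 \<longlongrightarrow> u2 0) (at_left 0)" "(W2 \<longlongrightarrow> v2 0) (at_right 0)"
    unfolding W_def W1_def[abs_def] W2_def[abs_def]
    by (intro tendsto_glue cont0)+
  then show "(W \<longlongrightarrow> u 0) (at_left 0)" "(W \<longlongrightarrow> v 0) (at_right 0)" by auto
  have "(deriv W \<longlongrightarrow> u1 0) (at_left 0)" "(deriv W \<longlongrightarrow> v1 0) (at_right 0)"
    "(deriv (deriv W) \<longlongrightarrow> u2 0) (at_left 0)" "(deriv (deriv W) \<longlongrightarrow> v2 0) (at_right 0)"
    using lims(3-6) dW ddW by (auto elim!: Lim_transform_eventually simp: eventually_at_filter)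
  moreover show "(W \<longlongrightarrow> a) at_bot"
    by (rule Lim_transform_eventually[OF lim(1) eventually_mono[OF eventually_gt_at_bot[of 0]]])
       (simp add: W_def)
  moreover show "(W \<longlongrightarrow> b) at_top"
    by (rule Lim_transform_eventually[OF lim(2) eventually_mono[OF eventually_gt_at_top[of 0]]])
       (simp add: W_def)
  ultimately show "profile_function W"
    using \<open>Ck_on 2 W (- {0})\<close> lims unfolding profile_function_def by auto
  have "continuous_on {..<0} u"
    by (intro continuous_at_imp_continuous_on ballI DERIV_isCont[OF u(1)]) (use \<open>\<delta> > 0\<close> in auto)
  moreover have "continuous_on (- {..<0}) v"
    by (intro continuous_at_imp_continuous_on ballI DERIV_isCont[OF v(1)]) (use \<open>\<delta> > 0\<close> in auto)
  ultimately have "(\<lambda>x. if x \<in> {..<0} then u x else v x) \<in> borel_measurable borel"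
    by (intro borel_measurable_continuous_on_if) auto
  then show "W \<in> borel_measurable borel" by (simp add: W_def)
qed

section \<open>The discontinuous travelling wave\<close>

theorem theorem2p11:
  fixes A B c :: real
  assumes "c = 1 + (A + B) / 2"
    and "B + 2 < c" and "c < A"
  shows "\<exists>W :: real \<Rightarrow> real.
           profile_function W \<and>
           Lim (at_left 0) W \<noteq> Lim (at_right 0) W \<and>
           (W \<longlongrightarrow> A) at_bot \<and> (W \<longlongrightarrow> B) at_top \<and>
           FW_weak_solution (\<lambda>x t. W (x - c * t)) W"
proof -
  define m where "m = (A - B) / 2"
  have "m > 1" using assms by (simp add: m_def)
  define E where "E = (m\<^sup>2 - 1) / 2"
  \<comment> \<open>Both end states of the profile have the same energy constant.\<close>
  have EL: "(1 - m)\<^sup>2 / 2 - (1 - m) = E" and ER: "(m + 1)\<^sup>2 / 2 - (m + 1) = E"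
    by (simp_all add: E_def power2_eq_square field_simps)
  \<comment> \<open>Positivity of the cofactor means that neither branch meets a further equilibrium.\<close>
  have okL: "v \<noteq> 0 \<and> energy_cofactor (1 - m) v > 0" if "v \<le> 1 - m" for v
  proof -
    have "v < 0" using that \<open>m > 1\<close> by linarith
    moreover have "(8 * v + 4 * (1 - m)) / 3 < 0" using \<open>v < 0\<close> \<open>m > 1\<close> by (intro divide_neg_pos add_neg_neg) auto
    moreover have "(v + (1 - m))\<^sup>2 \<ge> 0" by (rule zero_le_power2)
    ultimately show ?thesis unfolding energy_cofactor_def by linarith
  qed
  have okR: "v \<noteq> 0 \<and> energy_cofactor (m + 1) v > 0" if "v > 0" "v \<le> m + 1" for v
  proof -
    have "energy_cofactor (m + 1) v = v * (v + 2 * (m + 1) - 8 / 3) + (m + 1) * (m + 1 - 4 / 3)"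
      by (simp add: energy_cofactor_def power2_eq_square field_simps)
    moreover have "v * (v + 2 * (m + 1) - 8 / 3) > 0" "(m + 1) * (m + 1 - 4 / 3) > 0"
      using that \<open>m > 1\<close> by (auto intro!: mult_pos_pos)
    ultimately show ?thesis using that by linarith
  qed
  obtain \<delta>1 wL N1 where \<delta>1: "\<delta>1 > 0" and wL0: "wL 0 = -m" and wLlim: "(wL \<longlongrightarrow> 1 - m) at_top"
    and wL: "\<And>s. s > -\<delta>1 \<Longrightarrow> - m - 1 < wL s \<and> wL s < 1 - m \<and> (wL has_real_derivative branch_slope (1 - m) (wL s)) (at s)"
    and zL: "\<And>s. s > -\<delta>1 \<Longrightarrow> ((\<lambda>s. branch_slope (1 - m) (wL s)) has_real_derivative
        ((wL s)\<^sup>2 / 2 - wL s - E - (branch_slope (1 - m) (wL s))\<^sup>2) / wL s) (at s)"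
    and N1: "\<And>s. s > -\<delta>1 \<Longrightarrow> \<bar>wL s * branch_slope (1 - m) (wL s)\<bar> \<le> N1"
  proof (rule branch_exists[of "- m - 1" "- m" "1 - m", unfolded EL])
  qed (use okL in auto)
  obtain \<delta>2 wR N2 where \<delta>2: "\<delta>2 > 0" and wR0: "wR 0 = m" and wRlim: "(wR \<longlongrightarrow> m + 1) at_top"
    and wR: "\<And>s. s > -\<delta>2 \<Longrightarrow> 0 < wR s \<and> wR s < m + 1 \<and> (wR has_real_derivative branch_slope (m + 1) (wR s)) (at s)"
    and zR: "\<And>s. s > -\<delta>2 \<Longrightarrow> ((\<lambda>s. branch_slope (m + 1) (wR s)) has_real_derivative
        ((wR s)\<^sup>2 / 2 - wR s - E - (branch_slope (m + 1) (wR s))\<^sup>2) / wR s) (at s)"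
    and N2: "\<And>s. s > -\<delta>2 \<Longrightarrow> \<bar>wR s * branch_slope (m + 1) (wR s)\<bar> \<le> N2"
  proof (rule branch_exists[of 0 m "m + 1", unfolded ER])
  qed (use okR \<open>m > 1\<close> in auto)
  define zl where "zl s = branch_slope (1 - m) (wL s)" for s
  define zr where "zr s = branch_slope (m + 1) (wR s)" for s
  define \<delta> where "\<delta> = min \<delta>1 \<delta>2"
  have \<delta>: "\<delta> > 0" using \<delta>1 \<delta>2 by (simp add: \<delta>_def)
  \<comment> \<open>The left branch is traversed backwards: its orbit starts at the jump.\<close>
  define W where "W x = (if x < 0 then c - wL (- x) else c - wR x)" for x
  \<comment> \<open>The acceleration of a branch at position \<open>w\<close> with velocity \<open>z\<close>.\<close>
  define a where "a w z = (w\<^sup>2 / 2 - w - E - z\<^sup>2) / w" for w z :: real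
  have dwL: "((\<lambda>x. wL (- x)) has_real_derivative - zl (- x)) (at x)"
    and dzL: "((\<lambda>x. zl (- x)) has_real_derivative - a (wL (- x)) (zl (- x))) (at x)"
    and bL: "- m - 1 < wL (- x)" "wL (- x) < 1 - m" "wL (- x) \<noteq> 0" "\<bar>wL (- x) * zl (- x)\<bar> \<le> N1" if "x < \<delta>" for x
    using wL[of "-x"] zL[of "-x"] N1[of "-x"] that \<open>m > 1\<close> DERIV_mirror
    by (auto simp: zl_def[abs_def] a_def \<delta>_def)
  have dwR: "(wR has_real_derivative zr x) (at x)"
    and dzR: "(zr has_real_derivative a (wR x) (zr x)) (at x)"
    and bR: "0 < wR x" "wR x < m + 1" "\<bar>wR x * zr x\<bar> \<le> N2" if "x > - \<delta>" for x
    using wR[of x] zR[of x] N2[of x] that by (auto simp: zr_def[abs_def] a_def \<delta>_def)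
  have du: "((\<lambda>x. c - wL (- x)) has_real_derivative zl (- x)) (at x)" if "x < \<delta>" for x
    using dwL[OF that] by (auto intro!: derivative_eq_intros)
  have dv: "((\<lambda>x. c - wR x) has_real_derivative - zr x) (at x)" if "x > - \<delta>" for x
    using dwR[OF that] by (auto intro!: derivative_eq_intros)
  have dv1: "((\<lambda>x. - zr x) has_real_derivative - a (wR x) (zr x)) (at x)" if "x > - \<delta>" for x
    using dzR[OF that] by (rule DERIV_minus)
  have cu2: "isCont (\<lambda>x. - a (wL (- x)) (zl (- x))) x" if "x < \<delta>" for x
    unfolding a_def using bL(3)[OF that]
    by (intro continuous_intros DERIV_isCont[OF dwL[OF that]] DERIV_isCont[OF dzL[OF that]]) auto
  have cv2: "isCont (\<lambda>x. - a (wR x) (zr x)) x" if "x > - \<delta>" for x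
    unfolding a_def using bR(1)[OF that]
    by (intro continuous_intros DERIV_isCont[OF dwR[OF that]] DERIV_isCont[OF dzR[OF that]]) auto
  have limu: "((\<lambda>x. c - wL (- x)) \<longlongrightarrow> c - (1 - m)) at_bot"
    by (intro tendsto_intros filterlim_compose[OF wLlim filterlim_uminus_at_top_at_bot])
  have limv: "((\<lambda>x. c - wR x) \<longlongrightarrow> c - (m + 1)) at_top"
    by (intro tendsto_intros wRlim)
  note glue = profile_function_glue[OF \<delta> du dzL cu2 dv dv1 cv2 limu limv, folded W_def[abs_def]]
  \<comment> \<open>The convolution of the kernel with \<open>W\<close>, as predicted by the energy relation.\<close>
  define P where "P x = (if x < 0 then E + c - (wL (- x))\<^sup>2 / 2 else E + c - (wR x)\<^sup>2 / 2)" for x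
  define P' where "P' x = (if x < 0 then wL (- x) * zl (- x) else - (wR x * zr x))" for x
  \<comment> \<open>This equality singles out \<open>m\<close> as the starting value: it makes \<open>P'\<close> continuous at the jump.\<close>
  have match: "branch_slope (1 - m) (- m) = branch_slope (m + 1) m"
    using \<open>m > 1\<close> by (simp add: branch_slope_def energy_cofactor_def power2_eq_square field_simps)
  have dPL: "((\<lambda>x. E + c - (wL (- x))\<^sup>2 / 2) has_real_derivative wL (- x) * zl (- x)) (at x)"
    and dPL': "((\<lambda>x. wL (- x) * zl (- x)) has_real_derivative E + wL (- x) - (wL (- x))\<^sup>2 / 2) (at x)" if "x < \<delta>" for x
    using dwL[OF that] dzL[OF that] bL(3)[OF that]
    by (auto intro!: derivative_eq_intros simp: a_def power2_eq_square field_simps)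
  have dPR: "((\<lambda>x. E + c - (wR x)\<^sup>2 / 2) has_real_derivative - (wR x * zr x)) (at x)"
    and dPR': "((\<lambda>x. - (wR x * zr x)) has_real_derivative E + wR x - (wR x)\<^sup>2 / 2) (at x)" if "x > - \<delta>" for x
    using dwR[OF that] dzR[OF that] bR(1)[OF that]
    by (auto intro!: derivative_eq_intros simp: a_def power2_eq_square field_simps)
  have P'0: "wL (- 0) * zl (- 0) = - (wR 0 * zr 0)"
    by (simp add: zl_def zr_def wL0 wR0 match)
  have P0: "E + c - (wL (- 0))\<^sup>2 / 2 = E + c - (wR 0)\<^sup>2 / 2" by (simp add: wL0 wR0)
  have dP: "(P has_real_derivative P' x) (at x)" for x
  proof (cases "x = 0")
    case True
    then show ?thesis
      unfolding P_def[abs_def] P'_def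
      using has_real_derivative_glue[OF dPL[of 0, unfolded P'0] dPR[of 0] P0] \<delta> by simp
  next
    case False
    then show ?thesis
      unfolding P_def[abs_def] P'_def using dPL[of x] dPR[of x] \<delta>
      by (intro has_real_derivative_if_sign) auto
  qed
  have dP': "(P' has_real_derivative P x - W x) (at x)" if "x \<noteq> 0" for x
  proof -
    have "(P' has_real_derivative
        (if x < 0 then E + wL (- x) - (wL (- x))\<^sup>2 / 2 else E + wR x - (wR x)\<^sup>2 / 2)) (at x)"
      unfolding P'_def[abs_def] using dPL'[of x] dPR'[of x] \<delta> that
      by (intro has_real_derivative_if_sign) auto
    also have "(if x < 0 then E + wL (- x) - (wL (- x))\<^sup>2 / 2 else E + wR x - (wR x)\<^sup>2 / 2) = P x - W x"
      by (simp add: P_def W_def)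
    finally show ?thesis .
  qed
  have "isCont P' x" for x
  proof (cases "x = 0")
    case True
    have "isCont P' 0"
      unfolding isCont_def filterlim_at_split P'_def[abs_def]
      using tendsto_glue[OF DERIV_isCont[OF dPL'[of 0]] DERIV_isCont[OF dPR'[of 0]]] P'0 \<delta> by simp
    with True show ?thesis by simp
  qed (use dP' DERIV_isCont in blast)
  then have P'c: "continuous_on UNIV P'" by (intro continuous_at_imp_continuous_on) auto
  have bounds: "\<bar>W x - c\<bar> \<le> m + 1" "\<bar>P' x\<bar> \<le> max N1 N2" for x
    using bL[of x] bR[of x] \<delta> \<open>m > 1\<close> by (auto simp: W_def P'_def)
  have PW: "P x = E + c - (W x - c)\<^sup>2 / 2" for x
    by (simp add: P_def W_def)
  have bP: "\<bar>P x\<bar> \<le> \<bar>E + c\<bar> + (m + 1)\<^sup>2 / 2" for x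
  proof -
    have "(W x - c)\<^sup>2 \<le> (m + 1)\<^sup>2" using bounds(1)[of x] \<open>m > 1\<close> by (metis abs_le_square_iff abs_of_nonneg add_nonneg_nonneg less_eq_real_def zero_le_one order_trans)
    then show ?thesis unfolding PW using zero_le_power2[of "W x - c"] by linarith
  qed
  define M where "M = max (\<bar>c\<bar> + (m + 1)) (max (max N1 N2) (\<bar>E + c\<bar> + (m + 1)\<^sup>2 / 2))"
  have "FW_weak_solution (\<lambda>x t. W (x - c * t)) W"
  proof (rule weak_solution_of_profile[where P = P and P' = P' and M = M and E = "E + c - c\<^sup>2 / 2"])
    show "\<bar>W y\<bar> \<le> M" for y using bounds(1)[of y] unfolding M_def by linarith
    show "\<bar>P y\<bar> \<le> M" for y using bP[of y] unfolding M_def by linarith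
    show "\<bar>P' y\<bar> \<le> M" for y using bounds(2)[of y] unfolding M_def by linarith
    show "(W y)\<^sup>2 / 2 - c * W y + P y = E + c - c\<^sup>2 / 2" for y
      by (simp add: PW power2_eq_square field_simps)
  qed (use glue dP dP' P'c in auto)
  moreover have "Lim (at_left 0) W = c + m" "Lim (at_right 0) W = c - m"
    using glue(4,5) by (auto intro!: tendsto_Lim simp: wL0 wR0)
  moreover have "c - (1 - m) = A" "c - (m + 1) = B"
    using assms by (simp_all add: m_def field_simps)
  ultimately show ?thesis using glue \<open>m > 1\<close> by (intro exI[of _ W]) auto
qed

end
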